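(* Let $P\in\mathbb{Z}[x]$ be a monic polynomial of degree $d$ without multiple roots, with roots $\alpha_1,\dots,\alpha_d$. Then $f_P\in\mathbb{Q}(z)$, and all singularities of $f_P$ are simple poles located at numbers of the form $\alpha_1^{-e_1}\cdots\alpha_d^{-e_d}$, where $X_1^{e_1}\cdots X_d^{e_d}$ is a monomial occurring in the expansion of $\prod_{1\le j<k\le d}(X_j-X_k)^2$. Similarly, $g_P$ is a rational function whose singularities are simple poles located at numbers $\alpha_1^{-e_1}\cdots\alpha_d^{-e_d}$ where $X_1^{e_1}\cdots X_d^{e_d}$ is a monomial occurring in the expansion of $\prod_{1\le j<k\le d}(X_j-X_k)$.
   Context: For $n\ge1$, $P_n(x):=\prod_{j=1}^d(x-\alpha_j^n)\in\mathbb{Z}[x]$ and $\Delta(P_n)=\prod_{1\le j<k\le d}(\alpha_j^n-\alpha_k^n)^2$ is its discriminant. $f_P(z):=\sum_{n=1}^\infty\Delta(P_n)z^n$ and $g_P(z):=\sum_{n=1}^\infty b_nz^n$ with $b_n:=\prod_{1\le j<k\le d}\frac{\alpha_j^n-\alpha_k^n}{\alpha_j-\alpha_k}$. Here $X_1,\dots,X_d$ are indeterminates (so the monomials are those of the expansion of $\prod_{j<k}(\alpha_j^{-1}-\alpha_k^{-1})^2$, resp. $\prod_{j<k}(\alpha_j^{-1}-\alpha_k^{-1})$, as a polynomial in the $\alpha_i^{-1}$). *)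

theory Defs
  imports "HOL-Complex_Analysis.Complex_Analysis" "HOL-Library.Poly_Mapping"
begin

definition index_pairs :: "nat \<Rightarrow> (nat \<times> nat) set" where
  "index_pairs d = {(j, k). 1 \<le> j \<and> j < k \<and> k \<le> d}"

text \<open>The discriminant of \<open>P\<^sub>n = (\<Prod>j=1..d. [:- \<alpha> j ^ n, 1:])\<close>, the \<open>\<alpha> j\<close> being the roots of \<open>P\<close>.\<close>

definition disc_power :: "nat \<Rightarrow> (nat \<Rightarrow> complex) \<Rightarrow> nat \<Rightarrow> complex" where
  "disc_power d \<alpha> n = (\<Prod>(j, k)\<in>index_pairs d. (\<alpha> j ^ n - \<alpha> k ^ n)\<^sup>2)"

definition diff_quotient_power :: "nat \<Rightarrow> (nat \<Rightarrow> complex) \<Rightarrow> nat \<Rightarrow> complex" where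
  "diff_quotient_power d \<alpha> n =
     (\<Prod>(j, k)\<in>index_pairs d. (\<alpha> j ^ n - \<alpha> k ^ n) / (\<alpha> j - \<alpha> k))"

definition f_series :: "nat \<Rightarrow> (nat \<Rightarrow> complex) \<Rightarrow> complex fps" where
  "f_series d \<alpha> = Abs_fps (\<lambda>n. if n = 0 then 0 else disc_power d \<alpha> n)"

definition g_series :: "nat \<Rightarrow> (nat \<Rightarrow> complex) \<Rightarrow> complex fps" where
  "g_series d \<alpha> = Abs_fps (\<lambda>n. if n = 0 then 0 else diff_quotient_power d \<alpha> n)"

text \<open>
  Integer polynomials in indeterminates \<open>X\<^sub>i\<close> (\<open>i :: nat\<close>): finitely supported maps from
  exponent vectors to coefficients, multiplied by convolution. The monomials occurring in \<open>Q\<close>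
  (those with nonzero coefficient after collecting terms) are \<open>keys Q\<close>.
\<close>

type_synonym int_mpoly = "(nat \<Rightarrow>\<^sub>0 nat) \<Rightarrow>\<^sub>0 int"

definition indet :: "nat \<Rightarrow> int_mpoly" where
  "indet i = Poly_Mapping.single (Poly_Mapping.single i 1) 1"

definition vandermonde_mpoly :: "nat \<Rightarrow> int_mpoly" where
  "vandermonde_mpoly d = (\<Prod>(j, k)\<in>index_pairs d. indet j - indet k)"

definition disc_mpoly :: "nat \<Rightarrow> int_mpoly" where
  "disc_mpoly d = (\<Prod>(j, k)\<in>index_pairs d. (indet j - indet k)\<^sup>2)"

text \<open>
  The products of the powers \<open>\<alpha> j powi (- e j)\<close>, \<open>1 \<le> j \<le> d\<close>, for the monomials of \<open>Q\<close>
  with exponent vector \<open>e\<close>. One of the \<open>\<alpha> j\<close> may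
  be \<open>0\<close>; a monomial in which such an \<open>X\<^sub>j\<close> occurs yields no number and is excluded, so
  that the convention \<open>inverse 0 = 0\<close> plays no role.
\<close>

definition inverse_monomial_values :: "nat \<Rightarrow> (nat \<Rightarrow> complex) \<Rightarrow> int_mpoly \<Rightarrow> complex set" where
  "inverse_monomial_values d \<alpha> Q =
     {(\<Prod>j=1..d. \<alpha> j powi (- int (Poly_Mapping.lookup e j))) | e.
        e \<in> Poly_Mapping.keys Q \<and> (\<forall>j\<in>{1..d}. \<alpha> j = 0 \<longrightarrow> Poly_Mapping.lookup e j = 0)}"

text \<open>
  Elements of \<open>\<rat>(z)\<close> as functions on \<open>\<complex>\<close>. The fraction is in lowest terms, so the zeros of
  \<open>q\<close>, where HOL division returns \<open>0\<close>, are genuine poles and never removable singularities.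
\<close>

definition rat_rational_function :: "(complex \<Rightarrow> complex) \<Rightarrow> bool" where
  "rat_rational_function R \<longleftrightarrow>
     (\<exists>p q :: rat poly. q \<noteq> 0 \<and> coprime p q \<and>
        R = (\<lambda>z. poly (map_poly of_rat p) z / poly (map_poly of_rat q) z))"

definition simple_pole :: "(complex \<Rightarrow> complex) \<Rightarrow> complex \<Rightarrow> bool" where
  "simple_pole R w \<longleftrightarrow> isolated_singularity_at R w \<and> is_pole R w \<and> zorder R w = -1"

end

theory Submission
  imports Defs "Jordan_Normal_Form.Determinant" "HOL-Computational_Algebra.Field_as_Ring"
begin

text \<open>
  Expanding the product over pairs into monomials \<open>c\<^sub>e X\<^sup>e\<close> and evaluating at \<open>\<alpha>\<^sub>j\<^sup>n\<close> writes the
  coefficients of both series as \<open>\<Sum> c\<^sub>e \<beta>\<^sub>e\<^sup>n\<close> with \<open>\<beta>\<^sub>e = \<Prod> \<alpha>\<^sub>j\<^sup>e\<^sup>j\<close>, up to a constant factor.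
  Hence the series is a fraction over \<open>\<complex>\<close> with denominator \<open>\<Prod> (1 - b z)\<close> over the distinct
  values \<open>b\<close> of the \<open>\<beta>\<^sub>e\<close>, and every pole is simple and equal to some \<open>1 / \<beta>\<^sub>e\<close> with \<open>\<beta>\<^sub>e \<noteq> 0\<close>.
  The coefficients are rational because products of two Vandermonde determinants in powers of the
  \<open>\<alpha>\<^sub>j\<close> are determinants of power sums, and a complex rational function with rational Taylor
  coefficients is a quotient of rational polynomials.
\<close>

section \<open>Evaluation of integer polynomials in several indeterminates\<close>

text \<open>If \<open>\<phi>\<close> turns sums of exponent vectors into products and
  \<open>0\<close> into \<open>1\<close>, this is a ring homomorphism; for
  \<open>\<phi> = monomial_value d x\<close> it is evaluation at \<open>x\<close>.\<close>

definition linear_ext :: "('a \<Rightarrow> 'b) \<Rightarrow> ('a \<Rightarrow>\<^sub>0 int) \<Rightarrow> 'b :: comm_ring_1" where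
  "linear_ext \<phi> Q = (\<Sum>m\<in>Poly_Mapping.keys Q. of_int (Poly_Mapping.lookup Q m) * \<phi> m)"

lemma linear_ext_superset:
  assumes "finite A" "Poly_Mapping.keys Q \<subseteq> A"
  shows "linear_ext \<phi> Q = (\<Sum>m\<in>A. of_int (Poly_Mapping.lookup Q m) * \<phi> m)"
  unfolding linear_ext_def using assms
  by (intro sum.mono_neutral_left) (auto simp: in_keys_iff)

lemma linear_ext_single: "linear_ext \<phi> (Poly_Mapping.single m c) = of_int c * \<phi> m"
  by (subst linear_ext_superset[of "{m}"]) auto

lemma linear_ext_add: "linear_ext \<phi> (p + q) = linear_ext \<phi> p + linear_ext \<phi> q"
proof -
  let ?A = "Poly_Mapping.keys p \<union> Poly_Mapping.keys q"
  have "Poly_Mapping.keys (p + q) \<subseteq> ?A"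
    by (rule keys_add)
  then show ?thesis
    by (simp add: linear_ext_superset[of ?A] lookup_add distrib_right sum.distrib)
qed

lemma linear_ext_0: "linear_ext \<phi> 0 = 0"
  by (simp add: linear_ext_def)

lemma linear_ext_diff: "linear_ext \<phi> (p - q) = linear_ext \<phi> p - linear_ext \<phi> q"
  using linear_ext_add[of \<phi> "p - q" q] by simp

lemma linear_ext_sum: "linear_ext \<phi> (\<Sum>i\<in>I. f i) = (\<Sum>i\<in>I. linear_ext \<phi> (f i))"
  by (induction I rule: infinite_finite_induct) (auto simp: linear_ext_0 linear_ext_add)

lemma poly_mapping_sum_single:
  "(\<Sum>m\<in>Poly_Mapping.keys p. Poly_Mapping.single m (Poly_Mapping.lookup p m)) = p"
  by (rule poly_mapping_eqI) (auto simp: lookup_sum lookup_single when_def in_keys_iff)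

text \<open>Both factors are expanded into single terms, for which multiplication adds the
  exponents.\<close>

lemma linear_ext_mult:
  assumes \<phi>: "\<And>a b. \<phi> (a + b) = \<phi> a * \<phi> b"
  shows "linear_ext \<phi> (p * q) = linear_ext \<phi> p * linear_ext \<phi> q"
proof -
  have "p * q = (\<Sum>k\<in>Poly_Mapping.keys p. \<Sum>l\<in>Poly_Mapping.keys q.
      Poly_Mapping.single (k + l) (Poly_Mapping.lookup p k * Poly_Mapping.lookup q l))"
    by (subst poly_mapping_sum_single[of p, symmetric], subst poly_mapping_sum_single[of q, symmetric])
      (simp add: sum_product mult_single)
  then have "linear_ext \<phi> (p * q) = (\<Sum>k\<in>Poly_Mapping.keys p. \<Sum>l\<in>Poly_Mapping.keys q.
      (of_int (Poly_Mapping.lookup p k) * \<phi> k) * (of_int (Poly_Mapping.lookup q l) * \<phi> l))"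
    by (simp add: linear_ext_sum linear_ext_single \<phi> mult_ac)
  then show ?thesis
    by (simp add: linear_ext_def sum_product)
qed

lemma linear_ext_prod:
  assumes "\<And>a b. \<phi> (a + b) = \<phi> a * \<phi> b" and "\<phi> 0 = 1"
  shows "linear_ext \<phi> (\<Prod>i\<in>I. f i) = (\<Prod>i\<in>I. linear_ext \<phi> (f i))"
proof -
  have "linear_ext \<phi> 1 = 1"
    using assms(2) by (simp add: linear_ext_single flip: single_one)
  then show ?thesis
    by (induction I rule: infinite_finite_induct) (auto simp: linear_ext_mult assms(1))
qed

definition monomial_value :: "nat \<Rightarrow> (nat \<Rightarrow> 'a) \<Rightarrow> (nat \<Rightarrow>\<^sub>0 nat) \<Rightarrow> 'a :: comm_ring_1" where
  "monomial_value d x e = (\<Prod>j=1..d. x j ^ Poly_Mapping.lookup e j)"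

lemma monomial_value_add: "monomial_value d x (a + b) = monomial_value d x a * monomial_value d x b"
  by (simp add: monomial_value_def lookup_add power_add prod.distrib)

lemma monomial_value_zero: "monomial_value d x 0 = 1"
  by (simp add: monomial_value_def)

text \<open>This makes evaluation at \<open>n\<close>-th powers an exponential sum in
  \<open>n\<close>.\<close>

lemma monomial_value_power:
  "monomial_value d (\<lambda>j. x j ^ n) e = monomial_value d x e ^ n"
  by (simp add: monomial_value_def prod_power_distrib mult.commute flip: power_mult)

lemma linear_ext_indet:
  assumes "i \<in> {1..d}"
  shows "linear_ext (monomial_value d x) (indet i) = x i"
proof -
  have "monomial_value d x (Poly_Mapping.single i 1) = (\<Prod>j=1..d. if j = i then x j else 1)"
    unfolding monomial_value_def by (intro prod.cong) (auto simp: lookup_single when_def)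
  then show ?thesis
    using assms by (simp add: indet_def linear_ext_single)
qed

lemma linear_ext_vandermonde_mpoly:
  "linear_ext (monomial_value d x) (vandermonde_mpoly d) = (\<Prod>(j, k)\<in>index_pairs d. x j - x k)"
  unfolding vandermonde_mpoly_def
  by (subst linear_ext_prod[OF monomial_value_add monomial_value_zero], intro prod.cong)
    (auto simp: index_pairs_def linear_ext_diff linear_ext_indet)

lemma linear_ext_disc_mpoly:
  "linear_ext (monomial_value d x) (disc_mpoly d) = (\<Prod>(j, k)\<in>index_pairs d. (x j - x k)\<^sup>2)"
  unfolding disc_mpoly_def
  by (subst linear_ext_prod[OF monomial_value_add monomial_value_zero], intro prod.cong)
    (auto simp: index_pairs_def linear_ext_diff linear_ext_indet power2_eq_square
      linear_ext_mult[OF monomial_value_add])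

section \<open>Vandermonde determinants and rationality of their products\<close>

lemma degree_prod_linear:
  "degree (\<Prod>k<n. [:- x k, 1:] :: 'a :: idom poly) = n"
  by (subst degree_prod_eq_sum_degree) auto

lemma coeff_prod_linear: "coeff (\<Prod>k<n. [:- x k, 1:] :: 'a :: idom poly) n = 1"
  using lead_coeff_prod[of "\<lambda>k. [:- x k, 1:]" "{..<n}"] by (simp add: degree_prod_linear)

text \<open>Column operations of determinant 1 replace powers by monic polynomials, the
  \<open>j\<close>-th of which vanishes at the nodes before \<open>x j\<close>.\<close>

lemma det_vandermonde:
  fixes x :: "nat \<Rightarrow> 'a :: idom"
  shows "Determinant.det (Matrix.mat d d (\<lambda>(i, j). x i ^ j)) = (\<Prod>j<d. \<Prod>k<j. x j - x k)"
proof -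
  define V where "V = Matrix.mat d d (\<lambda>(i, j). x i ^ j)"
  \<comment> \<open>The columns of \<open>C\<close> hold the Newton basis \<open>p\<close>, so that \<open>V * C\<close> is triangular.\<close>
  define p where "p = (\<lambda>j. \<Prod>k<j. [:- x k, 1:])"
  define C where "C = Matrix.mat d d (\<lambda>(i, j). coeff (p j) i)"
  have [simp]: "V \<in> carrier_mat d d" "C \<in> carrier_mat d d"
    by (auto simp: V_def C_def)
  have VC: "V * C = Matrix.mat d d (\<lambda>(i, j). poly (p j) (x i))"
  proof (rule eq_matI)
    fix i j assume "i < dim_row (Matrix.mat d d (\<lambda>(i, j). poly (p j) (x i)))"
      "j < dim_col (Matrix.mat d d (\<lambda>(i, j). poly (p j) (x i)))"
    then have ij: "i < d" "j < d" by auto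
    have "(V * C) $$ (i, j) = (\<Sum>m<d. x i ^ m * coeff (p j) m)"
      using ij by (simp add: V_def C_def scalar_prod_def lessThan_atLeast0)
    also have "\<dots> = (\<Sum>m\<le>degree (p j). coeff (p j) m * x i ^ m)"
      using ij degree_prod_linear[of x j]
      by (intro sum.mono_neutral_cong_right) (auto simp: p_def coeff_eq_0)
    finally show "(V * C) $$ (i, j) = Matrix.mat d d (\<lambda>(i, j). poly (p j) (x i)) $$ (i, j)"
      using ij by (simp add: poly_altdef)
  qed (auto simp: V_def C_def)
  have "Determinant.det V * Determinant.det C = Determinant.det (V * C)"
    by (rule det_mult[symmetric, of _ d]) auto
  also have "\<dots> = prod_list (diag_mat (V * C))"
    by (rule det_lower_triangular[of d]) (auto simp: VC p_def poly_prod)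
  also have "\<dots> = (\<Prod>j<d. \<Prod>k<j. x j - x k)"
    by (simp add: VC prod_list_diag_prod p_def poly_prod lessThan_atLeast0)
  also have "Determinant.det C = prod_list (diag_mat C)"
  proof (rule det_upper_triangular[of _ d])
    show "upper_triangular C"
      using degree_prod_linear[of x]
      by (auto simp: upper_triangular_def C_def p_def intro!: coeff_eq_0)
  qed auto
  also have "\<dots> = 1"
    by (simp add: prod_list_diag_prod C_def p_def coeff_prod_linear)
  finally show ?thesis
    by (simp add: V_def)
qed

text \<open>Passes from pairs counted from 1 to the matrix indices counted from 0.\<close>

lemma prod_index_pairs:
  "(\<Prod>(j, k)\<in>index_pairs d. f j k) = (\<Prod>k<d. \<Prod>j<k. f (Suc j) (Suc k))"
proof -
  have "(\<Prod>k<d. \<Prod>j<k. f (Suc j) (Suc k)) = (\<Prod>(k, j)\<in>(SIGMA k:{..<d}. {..<k}). f (Suc j) (Suc k))"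
    by (rule prod.Sigma) auto
  also have "\<dots> = (\<Prod>(j, k)\<in>index_pairs d. f j k)"
    by (rule prod.reindex_bij_witness[of _ "\<lambda>(j, k). (k - 1, j - 1)" "\<lambda>(k, j). (Suc j, Suc k)"])
      (auto simp: index_pairs_def)
  finally show ?thesis ..
qed

text \<open>The sums in the assumption are the entries of \<open>V\<^sub>x\<^sup>T V\<^sub>y\<close> for Vandermonde matrices
  \<open>V\<^sub>x\<close> and \<open>V\<^sub>y\<close>; the product is its determinant.\<close>

lemma vandermonde_product_in_Rats:
  fixes x y :: "nat \<Rightarrow> complex"
  assumes "\<And>a b. (\<Sum>i=1..d. x i ^ a * y i ^ b) \<in> \<rat>"
  shows "(\<Prod>(j, k)\<in>index_pairs d. (x j - x k) * (y j - y k)) \<in> \<rat>"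
proof -
  define V where "V = (\<lambda>x :: nat \<Rightarrow> complex. Matrix.mat d d (\<lambda>(i, j). x (Suc i) ^ j))"
  define G where "G = (\<lambda>a b. \<Sum>i=1..d. x i ^ a * y i ^ b)"
  have G_Rats: "G a b \<in> \<rat>" for a b
    using assms by (simp add: G_def)
  have [simp]: "V x \<in> carrier_mat d d" for x
    by (auto simp: V_def)
  have det_V: "Determinant.det (V x) = (\<Prod>k<d. \<Prod>j<k. x (Suc k) - x (Suc j))" for x
    unfolding V_def by (rule det_vandermonde)
  \<comment> \<open>Both determinants have their differences in the opposite order, so the signs
    cancel in pairs.\<close>
  have "(\<Prod>(j, k)\<in>index_pairs d. (x j - x k) * (y j - y k)) = Determinant.det (V x) * Determinant.det (V y)"
    unfolding prod_index_pairs det_V prod.distrib[symmetric]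
    by (intro prod.cong refl) (simp add: algebra_simps)
  also have "\<dots> = Determinant.det ((V x)\<^sup>T * V y)"
    by (subst det_mult[of _ d]) (auto simp: det_transpose[of _ d])
  also have "(V x)\<^sup>T * V y = Matrix.mat d d (\<lambda>(a, b). G a b)" (is "_ = ?G")
  proof (rule eq_matI)
    fix a b assume "a < dim_row ?G" "b < dim_col ?G"
    then have ab: "a < d" "b < d" by auto
    have "((V x)\<^sup>T * V y) $$ (a, b) = (\<Sum>i<d. x (Suc i) ^ a * y (Suc i) ^ b)"
      using ab by (simp add: V_def scalar_prod_def lessThan_atLeast0)
    also have "\<dots> = G a b"
      unfolding G_def by (rule sum.reindex_bij_witness[of _ "\<lambda>i. i - 1" Suc]) auto
    finally show "((V x)\<^sup>T * V y) $$ (a, b) = ?G $$ (a, b)"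
      using ab by simp
  qed (auto simp: V_def)
  \<comment> \<open>By the Leibniz formula the determinant is a signed sum of products of rational
    entries.\<close>
  also have "Determinant.det \<dots> \<in> \<rat>"
    by (subst det_def'[of _ d]) (auto intro!: Rats_sum Rats_mult Rats_prod G_Rats simp: sign_def)
  finally show ?thesis .
qed

section \<open>Power series of rational functions, and descent from complex to rational
  coefficients\<close>

lemma fps_geometric_mult_linear:
  "Abs_fps (\<lambda>n. b ^ n) * fps_of_poly [:1, - b:] = (1 :: 'a :: comm_ring_1 fps)"
proof (rule fps_ext)
  fix n
  show "fps_nth (Abs_fps (\<lambda>n. b ^ n) * fps_of_poly [:1, - b:]) n = fps_nth 1 n"
    by (cases n) (simp_all add: fps_of_poly_linear' algebra_simps fps_of_poly_pCons)
qed

text \<open>Applying a \<open>\<rat>\<close>-linear functional to the coefficients of \<open>D\<close> and \<open>N\<close> preserves the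
  relation; the functional is chosen not to vanish on some coefficient of \<open>D\<close>.\<close>

lemma rational_fps_descends_to_rat:
  fixes G :: "rat fps" and N D :: "complex poly"
  assumes eq: "Abs_fps (\<lambda>n. of_rat (fps_nth G n)) * fps_of_poly D = fps_of_poly N" and "D \<noteq> 0"
  shows "\<exists>p q :: rat poly. q \<noteq> 0 \<and> G * fps_of_poly q = fps_of_poly p"
proof -
  interpret vector_space_pair "\<lambda>(r::rat) (x::complex). of_rat r * x" "(*) :: rat \<Rightarrow> rat \<Rightarrow> rat"
    by unfold_locales (auto simp: algebra_simps of_rat_add of_rat_mult)
  have "coeff D (degree D) \<noteq> 0"
    using \<open>D \<noteq> 0\<close> by simp
  then have "\<not> vs1.dependent {coeff D (degree D)}"
    by simp
  from linear_independent_extend[OF this, of "\<lambda>_. 1"]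
  obtain \<phi> :: "complex \<Rightarrow> rat" where "Vector_Spaces.linear (\<lambda>r x. of_rat r * x) (*) \<phi>"
    and \<phi>_D: "\<phi> (coeff D (degree D)) = 1"
    by auto
  then interpret \<phi>: Vector_Spaces.linear "\<lambda>(r::rat) (x::complex). of_rat r * x" "(*)" \<phi>
    by blast
  have coeff_map: "coeff (map_poly \<phi> p) n = \<phi> (coeff p n)" for p n
    by (simp add: coeff_map_poly \<phi>.zero)
  have "G * fps_of_poly (map_poly \<phi> D) = fps_of_poly (map_poly \<phi> N)"
  proof (rule fps_ext)
    fix n
    \<comment> \<open>The coefficients of \<open>G\<close> are rational scalars, so
      \<open>\<phi>\<close> moves past them in the convolution.\<close>
    have "\<phi> (coeff N n) = \<phi> (\<Sum>i=0..n. of_rat (fps_nth G i) * coeff D (n - i))"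
      using arg_cong[OF eq, of "\<lambda>F. \<phi> (fps_nth F n)"] by (simp add: fps_mult_nth)
    also have "\<dots> = (\<Sum>i=0..n. fps_nth G i * \<phi> (coeff D (n - i)))"
      by (simp add: \<phi>.sum \<phi>.scale)
    finally show "fps_nth (G * fps_of_poly (map_poly \<phi> D)) n = fps_nth (fps_of_poly (map_poly \<phi> N)) n"
      by (simp add: fps_mult_nth coeff_map)
  qed
  moreover have "map_poly \<phi> D \<noteq> 0"
    using coeff_map[of D "degree D"] \<phi>_D by auto
  ultimately show ?thesis
    by blast
qed

lemma rational_fps_coprime:
  fixes G :: "rat fps"
  assumes "q \<noteq> 0" "G * fps_of_poly q = fps_of_poly p"
  shows "\<exists>p q. q \<noteq> 0 \<and> coprime p q \<and> G * fps_of_poly q = fps_of_poly p"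
proof -
  define g where "g = gcd p q"
  have "g \<noteq> 0"
    using assms(1) by (simp add: g_def)
  then obtain p' q' where pq: "p = p' * g" "q = q' * g" "coprime p' q'"
    using gcd_coprime_exists[of p q] unfolding g_def by blast
  have "(G * fps_of_poly q') * fps_of_poly g = fps_of_poly p' * fps_of_poly g"
    using assms(2) by (simp add: pq fps_of_poly_mult mult_ac)
  then have "G * fps_of_poly q' = fps_of_poly p'"
    using \<open>g \<noteq> 0\<close> by (simp add: fps_of_poly_eq_iff[of g 0, simplified])
  then show ?thesis
    using pq assms(1) by auto
qed

lemma map_poly_of_rat_mult:
  "map_poly (of_rat :: rat \<Rightarrow> 'a :: field_char_0) (p * q) = map_poly of_rat p * map_poly of_rat q"
  by (rule poly_eqI) (simp add: coeff_map_poly coeff_mult of_rat_sum of_rat_mult)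

lemma map_poly_of_rat_add:
  "map_poly (of_rat :: rat \<Rightarrow> 'a :: field_char_0) (p + q) = map_poly of_rat p + map_poly of_rat q"
  by (rule poly_eqI) (simp add: coeff_map_poly of_rat_add)

text \<open>A Bezout identity survives field extension; hence coprime rational polynomials have no
  common complex root.\<close>

lemma coprime_rat_bezout:
  fixes p q :: "rat poly"
  assumes "coprime p q"
  obtains u v where "map_poly of_rat u * map_poly of_rat p + map_poly of_rat v * map_poly of_rat q
    = (1 :: 'a :: field_char_0 poly)"
proof -
  define u v where "u = fst (bezout_coefficients p q)" and "v = snd (bezout_coefficients p q)"
  have "u * p + v * q = 1"
    using assms bezout_coefficients_fst_snd[of p q] by (simp add: u_def v_def)
  then have "map_poly of_rat (u * p + v * q) = (map_poly of_rat 1 :: 'a poly)"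
    by simp
  then show ?thesis
    by (intro that[of u v]) (simp add: map_poly_of_rat_add map_poly_of_rat_mult)
qed

section \<open>Simple poles and generating functions of exponential sums\<close>

lemma simple_pole_divide_poly:
  fixes p q :: "complex poly"
  assumes "q = [:- w, 1:] * q'" "poly q' w \<noteq> 0" "poly p w \<noteq> 0"
  shows "simple_pole (\<lambda>z. poly p z / poly q z) w"
proof -
  define R where "R = (\<lambda>z. poly p z / poly q z)"
  define g where "g = (\<lambda>z. poly p z / poly q' z)"
  define S where "S = {z. poly q' z \<noteq> 0}"
  have "open S"
    unfolding S_def by (intro open_Collect_neq continuous_intros)
  have "w \<in> S"
    using assms by (simp add: S_def)
  have holo: "g holomorphic_on S"
    unfolding g_def S_def by (intro holomorphic_intros) auto
  \<comment> \<open>Valid for every \<open>z\<close>: at zeros of \<open>q\<close> both sides are 0,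
    the value of division by 0.\<close>
  have R_eq: "R z = g z / (z - w)" for z
  proof -
    have "poly q z = (z - w) * poly q' z"
      by (simp add: assms(1) algebra_simps)
    then show ?thesis
      by (simp add: R_def g_def)
  qed
  have gw: "g w \<noteq> 0"
    using assms by (simp add: g_def)
  have "zorder R w = -1"
    by (rule zorder_eqI[OF \<open>open S\<close> \<open>w \<in> S\<close> holo gw]) (simp add: R_eq power_int_minus divide_inverse)
  moreover have "is_pole R w"
  proof -
    have "isCont g w"
      using holo \<open>open S\<close> \<open>w \<in> S\<close> by (meson continuous_on_eq_continuous_at holomorphic_on_imp_continuous_on)
    then have "g \<midarrow>w\<rightarrow> g w"
      by (simp add: isCont_def)
    then have "LIM z at w. g z / (z - w) :> at_infinity"
      using gw by (intro filterlim_divide_at_infinity[of g "g w"])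
        (auto simp: filterlim_at eventually_at_filter intro!: tendsto_eq_intros)
    then show ?thesis
      by (simp add: is_pole_def R_eq[abs_def])
  qed
  moreover have "isolated_singularity_at R w"
  proof -
    have "(\<lambda>z. g z / (z - w)) holomorphic_on S - {w}"
      using holo by (intro holomorphic_intros) (auto intro: holomorphic_on_subset)
    then have "R analytic_on S - {w}"
      using \<open>open S\<close> by (subst analytic_on_open) (auto simp: R_eq[abs_def])
    moreover obtain r where "r > 0" "ball w r \<subseteq> S"
      using \<open>open S\<close> \<open>w \<in> S\<close> openE by blast
    ultimately show ?thesis
      unfolding isolated_singularity_at_def by (meson Diff_mono analytic_on_subset subset_refl)
  qed
  ultimately show ?thesis
    by (simp add: simple_pole_def R_def)
qed

text \<open>Each exponential is a geometric series. Coinciding values of \<open>\<beta>\<close>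
  share one factor of the denominator, so that its roots are simple.\<close>

lemma exponential_sum_times_denominator:
  fixes c \<beta> :: "'i \<Rightarrow> complex"
  assumes "finite S" and "fps_nth F 0 = 0"
    and F: "\<And>n. n > 0 \<Longrightarrow> fps_nth F n = (\<Sum>s\<in>S. c s * \<beta> s ^ n)"
  shows "\<exists>N. F * fps_of_poly (\<Prod>b\<in>\<beta> ` S. [:1, - b:]) = fps_of_poly N"
proof -
  define B where "B = \<beta> ` S"
  define D where "D = (\<Prod>b\<in>B. [:1, - b:])"
  \<comment> \<open>The subtracted multiple of \<open>D\<close> removes the terms at
    \<open>n = 0\<close>, since \<open>F\<close> has constant term 0.\<close>
  define N where "N = (\<Sum>s\<in>S. Polynomial.smult (c s) (\<Prod>b\<in>B - {\<beta> s}. [:1, - b:])) - Polynomial.smult (\<Sum>s\<in>S. c s) D"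
  have D_split: "D = [:1, - \<beta> s:] * (\<Prod>b\<in>B - {\<beta> s}. [:1, - b:])" if "s \<in> S" for s
    unfolding D_def using that \<open>finite S\<close> by (subst prod.remove[of B "\<beta> s"]) (auto simp: B_def)
  have F_eq: "F = (\<Sum>s\<in>S. fps_const (c s) * Abs_fps (\<lambda>n. \<beta> s ^ n)) - fps_const (\<Sum>s\<in>S. c s)"
  proof (rule fps_ext)
    fix n
    show "fps_nth F n = fps_nth ((\<Sum>s\<in>S. fps_const (c s) * Abs_fps (\<lambda>n. \<beta> s ^ n)) - fps_const (\<Sum>s\<in>S. c s)) n"
      using assms(2) F[of n] by (cases "n = 0") (simp_all add: fps_sum_nth)
  qed
  have "fps_const (c s) * Abs_fps (\<lambda>n. \<beta> s ^ n) * fps_of_poly D =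
      fps_of_poly (Polynomial.smult (c s) (\<Prod>b\<in>B - {\<beta> s}. [:1, - b:]))" if "s \<in> S" for s
  proof -
    have "Abs_fps (\<lambda>n. \<beta> s ^ n) * fps_of_poly D = fps_of_poly (\<Prod>b\<in>B - {\<beta> s}. [:1, - b:])"
      by (simp only: D_split[OF that] fps_of_poly_mult mult.assoc[symmetric]
        fps_geometric_mult_linear mult_1)
    then show ?thesis
      by (simp add: mult.assoc fps_of_poly_smult)
  qed
  then have "F * fps_of_poly D = fps_of_poly N"
    by (simp add: F_eq N_def left_diff_distrib sum_distrib_right fps_of_poly_diff fps_of_poly_sum
        fps_of_poly_smult[of "\<Sum>s\<in>S. c s"] del: mult_cancel_left)
  then show ?thesis
    unfolding D_def B_def by blast
qed

text \<open>\<open>F\<close> is a complex fraction \<open>N / D\<close> with known simple roots of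
  \<open>D\<close>, and also a rational fraction in lowest terms; the latter's denominator divides
  \<open>D\<close>, so its roots are simple and among those of \<open>D\<close>.\<close>

lemma exponential_sum_rational_function:
  fixes c \<beta> :: "'i \<Rightarrow> complex"
  assumes fin: "finite S" and F0: "fps_nth F 0 = 0"
    and F: "\<And>n. n > 0 \<Longrightarrow> fps_nth F n = (\<Sum>s\<in>S. c s * \<beta> s ^ n)"
    and rats: "\<And>n. fps_nth F n \<in> \<rat>"
  shows "\<exists>R. rat_rational_function R \<and> R has_fps_expansion F \<and>
    (\<forall>w. \<not> R analytic_on {w} \<longrightarrow> simple_pole R w \<and> (\<exists>s\<in>S. \<beta> s \<noteq> 0 \<and> w = inverse (\<beta> s)))"
proof -
  define B where "B = \<beta> ` S"
  define D where "D = (\<Prod>b\<in>B. [:1, - b:])"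
  have "finite B"
    using fin by (simp add: B_def)
  obtain N where N: "F * fps_of_poly D = fps_of_poly N"
    using exponential_sum_times_denominator[OF fin F0 F] unfolding D_def B_def by blast
  have "\<exists>r. fps_nth F n = of_rat r" for n
    using rats[of n] by (elim Rats_cases) auto
  then obtain r where r: "fps_nth F n = of_rat (r n)" for n
    by metis
  define G where "G = Abs_fps r"
  have F_G: "F = Abs_fps (\<lambda>n. of_rat (fps_nth G n))"
    by (simp add: fps_eq_iff G_def r)
  have D_0: "poly D 0 = 1"
    by (simp add: D_def poly_prod)
  then have "D \<noteq> 0"
    by auto
  then obtain p q :: "rat poly" where "q \<noteq> 0" "coprime p q" and pq: "G * fps_of_poly q = fps_of_poly p"
    using rational_fps_descends_to_rat[OF N[unfolded F_G]] rational_fps_coprime by metis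
  define p' q' :: "complex poly" where "p' = map_poly of_rat p" and "q' = map_poly of_rat q"
  define R where "R = (\<lambda>z. poly p' z / poly q' z)"
  have Fq: "F * fps_of_poly q' = fps_of_poly p'"
  proof (rule fps_ext)
    fix n
    show "fps_nth (F * fps_of_poly q') n = fps_nth (fps_of_poly p') n"
      using arg_cong[OF pq, of "\<lambda>H. of_rat (fps_nth H n) :: complex"]
      by (simp add: F_G q'_def p'_def fps_mult_nth coeff_map_poly of_rat_sum of_rat_mult)
  qed
  \<comment> \<open>Both fractions represent \<open>F\<close>, so their cross products
    agree.\<close>
  have "fps_of_poly (N * q') = fps_of_poly (p' * D)"
    unfolding fps_of_poly_mult N[symmetric] Fq[symmetric] by (simp add: mult_ac)
  then have Nq: "N * q' = p' * D"
    by (simp only: fps_of_poly_eq_iff)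
  obtain u v where uv: "u * p' + v * q' = 1"
    using coprime_rat_bezout[OF \<open>coprime p q\<close>, where ?'a = complex]
    unfolding p'_def q'_def by metis
  \<comment> \<open>\<open>q'\<close> divides \<open>D\<close>, which has simple roots.\<close>
  define T where "T = u * N + v * D"
  have "D = (u * p' + v * q') * D"
    by (simp add: uv)
  also have "\<dots> = q' * T"
    by (simp add: T_def algebra_simps Nq)
  finally have D_T: "D = q' * T" .
  \<comment> \<open>As 0 is no root of \<open>q'\<close>, the expansion of \<open>R\<close> at 0 is
    the quotient of the two power series.\<close>
  have q'_0: "poly q' 0 \<noteq> 0"
    using D_0 by (auto simp: D_T)
  have "rat_rational_function R"
    unfolding rat_rational_function_def R_def p'_def q'_def
    using \<open>q \<noteq> 0\<close> \<open>coprime p q\<close> by blast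
  moreover have "R has_fps_expansion F"
  proof -
    have poly_exp: "poly f has_fps_expansion fps_of_poly f" for f :: "complex poly"
      by (simp add: has_fps_expansion_def)
    have "R has_fps_expansion (fps_of_poly p' / fps_of_poly q')"
      unfolding R_def using q'_0
      by (intro has_fps_expansion_divide' poly_exp) (simp add: poly_0_coeff_0)
    also have "fps_of_poly p' / fps_of_poly q' = F"
    proof -
      have "fps_of_poly q' \<noteq> 0"
        using q'_0 by auto
      then show ?thesis
        by (simp flip: Fq)
    qed
    finally show ?thesis .
  qed
  moreover have "simple_pole R w \<and> (\<exists>s\<in>S. \<beta> s \<noteq> 0 \<and> w = inverse (\<beta> s))" if "\<not> R analytic_on {w}" for w
  proof -
    have q'_w: "poly q' w = 0"
    proof (rule ccontr)
      assume "poly q' w \<noteq> 0"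
      moreover have "poly f analytic_on {w}" for f :: "complex poly"
        by (rule analytic_on_subset[of _ UNIV]) (auto simp: analytic_on_open poly_holomorphic_on)
      ultimately have "R analytic_on {w}"
        unfolding R_def by (intro analytic_on_divide) auto
      with that show False by simp
    qed
    then have "poly D w = 0"
      by (simp add: D_T)
    then obtain b where b: "b \<in> B" "1 - b * w = 0"
      using \<open>finite B\<close> by (auto simp: D_def poly_prod mult.commute)
    \<comment> \<open>A value 0 gives the constant factor 1, which has no root.\<close>
    then have "b \<noteq> 0" and w: "w = inverse b"
      using inverse_unique[of b w] by auto
    define D0 where "D0 = (\<Prod>b\<in>B - {b}. [:1, - b:])"
    have D_D0: "D = [:1, - b:] * D0"
      unfolding D_def D0_def using b \<open>finite B\<close> by (intro prod.remove) auto
    have D0_w: "poly D0 w \<noteq> 0"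
      using \<open>finite B\<close> \<open>b \<noteq> 0\<close> by (auto simp: D0_def poly_prod w field_simps)
    obtain q1 where q1: "q' = [:- w, 1:] * q1"
      using q'_w by (auto simp: poly_eq_0_iff_dvd elim: dvdE)
    \<comment> \<open>From \<open>w = inverse b\<close> follows
      \<open>1 - b z = - b (z - w)\<close>; cancelling \<open>z - w\<close> leaves a polynomial
      nonzero at \<open>w\<close>, so \<open>w\<close> is a simple root of
      \<open>q'\<close>.\<close>
    have "[:- w, 1:] * (q1 * T) = [:- w, 1:] * Polynomial.smult (- b) D0"
      using D_T D_D0 \<open>b \<noteq> 0\<close> by (simp add: q1 w algebra_simps)
    then have "q1 * T = Polynomial.smult (- b) D0"
      by (subst (asm) mult_left_cancel) auto
    then have "poly q1 w * poly T w = - b * poly D0 w"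
      by (metis poly_mult poly_smult)
    then have "poly q1 w \<noteq> 0"
      using D0_w \<open>b \<noteq> 0\<close> by auto
    \<comment> \<open>At \<open>w\<close> the Bezout identity reduces to
      \<open>u p' = 1\<close>.\<close>
    moreover have "poly p' w \<noteq> 0"
      using arg_cong[OF uv, of "\<lambda>f. poly f w"] q'_w by auto
    ultimately have "simple_pole R w"
      unfolding R_def using q1 by (intro simple_pole_divide_poly)
    with b w \<open>b \<noteq> 0\<close> show ?thesis
      by (auto simp: B_def)
  qed
  ultimately show ?thesis
    by blast
qed

section \<open>From exponential sums back to monomials in the roots\<close>

text \<open>A nonzero value forces exponent 0 at every vanishing \<open>\<alpha> j\<close>, as the
  side condition of \<open>inverse_monomial_values\<close> demands.\<close>

lemma inverse_monomial_valuesI: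
  assumes "e \<in> Poly_Mapping.keys Q" and "monomial_value d \<alpha> e \<noteq> 0"
  shows "inverse (monomial_value d \<alpha> e) \<in> inverse_monomial_values d \<alpha> Q"
proof -
  have "inverse (monomial_value d \<alpha> e) = (\<Prod>j=1..d. \<alpha> j powi (- int (Poly_Mapping.lookup e j)))"
    by (simp add: monomial_value_def power_int_minus prod_inversef[symmetric])
  moreover have "\<forall>j\<in>{1..d}. \<alpha> j = 0 \<longrightarrow> Poly_Mapping.lookup e j = 0"
    using assms(2) by (auto simp: monomial_value_def)
  ultimately show ?thesis
    unfolding inverse_monomial_values_def using assms(1) by blast
qed

text \<open>The constant \<open>K\<close> accommodates the fixed denominator of the coefficients of
  \<open>g_series\<close>.\<close>

lemma mpoly_at_powers_rational_function:
  assumes "fps_nth F 0 = 0"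
    and F: "\<And>n. n > 0 \<Longrightarrow> fps_nth F n = K * linear_ext (monomial_value d (\<lambda>j. \<alpha> j ^ n)) Q"
    and "\<And>n. fps_nth F n \<in> \<rat>"
  shows "\<exists>R. rat_rational_function R \<and> R has_fps_expansion F \<and>
    (\<forall>w. \<not> R analytic_on {w} \<longrightarrow> simple_pole R w \<and> w \<in> inverse_monomial_values d \<alpha> Q)"
proof -
  have "fps_nth F n = (\<Sum>e\<in>Poly_Mapping.keys Q.
      (K * of_int (Poly_Mapping.lookup Q e)) * monomial_value d \<alpha> e ^ n)" if "n > 0" for n
    using F[OF that] by (simp add: linear_ext_def monomial_value_power sum_distrib_left mult.assoc)
  from exponential_sum_rational_function[OF finite_keys assms(1) this assms(3)]
  show ?thesis
    using inverse_monomial_valuesI by metis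
qed

section \<open>Rationality of the power sums of the roots\<close>

text \<open>\<open>\<Sum> \<alpha>\<^sub>j\<^sup>n\<^sup>+\<^sup>1 z\<^sup>n\<close> is minus the logarithmic derivative of \<open>A = \<Prod> (1 - \<alpha>\<^sub>j z)\<close>, which has
  integer coefficients and constant term 1.\<close>

lemma power_sum_in_Rats:
  fixes P :: "int poly" and \<alpha> :: "nat \<Rightarrow> complex"
  assumes "map_poly of_int P = (\<Prod>j=1..d. [:- \<alpha> j, 1:])"
  shows "(\<Sum>j=1..d. \<alpha> j ^ n) \<in> \<rat>"
proof -
  define A where "A = (\<Prod>j=1..d. [:1, - \<alpha> j:])"
  define S where "S = Abs_fps (\<lambda>n. \<Sum>j=1..d. \<alpha> j ^ Suc n)"
  \<comment> \<open>For \<open>a = 0\<close> the degree drops and both sides are 1.\<close>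
  have "reflect_poly [:- a, 1:] = [:1, - a:]" for a :: complex
    by (cases "a = 0") (simp_all add: reflect_poly_def)
  then have "A = reflect_poly (map_poly of_int P)"
    by (simp add: A_def assms reflect_poly_prod)
  then have A_Rats: "coeff A i \<in> \<rat>" for i
    by (simp add: coeff_reflect_poly coeff_map_poly)
  have A_0: "coeff A 0 = 1"
    by (simp add: A_def poly_prod flip: poly_0_coeff_0)
  have S_eq: "S = (\<Sum>j=1..d. fps_const (\<alpha> j) * Abs_fps (\<lambda>n. \<alpha> j ^ n))"
    by (simp add: S_def fps_eq_iff fps_sum_nth)
  have "fps_const (\<alpha> j) * Abs_fps (\<lambda>n. \<alpha> j ^ n) * fps_of_poly A =
      - fps_of_poly ((\<Prod>k\<in>{1..d} - {j}. [:1, - \<alpha> k:]) * pderiv [:1, - \<alpha> j:])" if "j \<in> {1..d}" for j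
  proof -
    have "A = [:1, - \<alpha> j:] * (\<Prod>k\<in>{1..d} - {j}. [:1, - \<alpha> k:])"
      unfolding A_def using that by (intro prod.remove) auto
    then have "Abs_fps (\<lambda>n. \<alpha> j ^ n) * fps_of_poly A = fps_of_poly (\<Prod>k\<in>{1..d} - {j}. [:1, - \<alpha> k:])"
      by (simp only: fps_of_poly_mult mult.assoc[symmetric] fps_geometric_mult_linear mult_1)
    then show ?thesis
      by (simp add: mult.assoc pderiv_pCons fps_of_poly_smult fps_of_poly_uminus)
  qed
  then have SA: "S * fps_of_poly A = - fps_of_poly (pderiv A)"
    unfolding S_eq sum_distrib_right
    by (simp add: A_def pderiv_prod fps_of_poly_sum sum_negf)
  \<comment> \<open>Newton's identities: since \<open>A\<close> has constant term 1, each
    coefficient of \<open>S\<close> is determined by the earlier ones.\<close>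
  have "fps_nth S n \<in> \<rat>" for n
  proof (induction n rule: less_induct)
    case (less n)
    have "(\<Sum>i=0..n. fps_nth S i * coeff A (n - i)) = - coeff (pderiv A) n"
      using arg_cong[OF SA, of "\<lambda>F. fps_nth F n"] by (simp add: fps_mult_nth)
    also have "{0..n} = insert n {..<n}"
      by auto
    finally have "fps_nth S n = - coeff (pderiv A) n - (\<Sum>i<n. fps_nth S i * coeff A (n - i))"
      by (simp add: A_0 algebra_simps)
    also have "\<dots> \<in> \<rat>"
      using less A_Rats by (auto simp: coeff_pderiv intro!: Rats_diff Rats_sum Rats_mult Rats_add)
    finally show ?case .
  qed
  then have "(\<Sum>j=1..d. \<alpha> j ^ Suc m) \<in> \<rat>" for m
    by (simp add: S_def)
  \<comment> \<open>\<open>S\<close> starts with the first power sum; the one for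
    \<open>n = 0\<close> is the integer \<open>d\<close>.\<close>
  then show ?thesis
    by (cases n) auto
qed

theorem theorem7p2:
  fixes P :: "int poly" and d :: nat and \<alpha> :: "nat \<Rightarrow> complex"
  assumes monic: "lead_coeff P = 1"
    and deg: "degree P = d"
    and no_multiple_roots: "rsquarefree (map_poly of_int P :: complex poly)"
    and roots: "map_poly of_int P = (\<Prod>j=1..d. [:- \<alpha> j, 1:])"
  shows "(\<exists>R. rat_rational_function R \<and> R has_fps_expansion f_series d \<alpha> \<and>
            (\<forall>w. \<not> R analytic_on {w} \<longrightarrow>
               simple_pole R w \<and> w \<in> inverse_monomial_values d \<alpha> (disc_mpoly d))) \<and>
         (\<exists>R. rat_rational_function R \<and> R has_fps_expansion g_series d \<alpha> \<and>
            (\<forall>w. \<not> R analytic_on {w} \<longrightarrow>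
               simple_pole R w \<and> w \<in> inverse_monomial_values d \<alpha> (vandermonde_mpoly d)))"
proof
  \<comment> \<open>Equal exponents give the discriminants; the mixed case with one exponent 1
    serves the quotients.\<close>
  have mixed_Rats: "(\<Prod>(j, k)\<in>index_pairs d. (\<alpha> j ^ m - \<alpha> k ^ m) * (\<alpha> j ^ n - \<alpha> k ^ n)) \<in> \<rat>" for m n
  proof (rule vandermonde_product_in_Rats)
    fix a b
    show "(\<Sum>i=1..d. (\<alpha> i ^ m) ^ a * (\<alpha> i ^ n) ^ b) \<in> \<rat>"
      using power_sum_in_Rats[OF roots, of "m * a + n * b"] by (simp add: power_add power_mult)
  qed
  have disc_Rats: "disc_power d \<alpha> n \<in> \<rat>" for n
    using mixed_Rats[of n n] by (simp add: disc_power_def power2_eq_square)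
  show "\<exists>R. rat_rational_function R \<and> R has_fps_expansion f_series d \<alpha> \<and>
      (\<forall>w. \<not> R analytic_on {w} \<longrightarrow>
         simple_pole R w \<and> w \<in> inverse_monomial_values d \<alpha> (disc_mpoly d))"
  proof (rule mpoly_at_powers_rational_function[where K = 1])
    show "fps_nth (f_series d \<alpha>) n \<in> \<rat>" for n
      by (simp add: f_series_def disc_Rats)
  qed (simp_all add: f_series_def linear_ext_disc_mpoly disc_power_def)
  define V where "V = (\<lambda>n. \<Prod>(j, k)\<in>index_pairs d. \<alpha> j ^ n - \<alpha> k ^ n)"
  have quotient_eq: "diff_quotient_power d \<alpha> n = V n / V 1" for n
    by (simp add: diff_quotient_power_def V_def case_prod_unfold prod_dividef)
  have "V m * V n \<in> \<rat>" for m n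
    using mixed_Rats[of m n] by (simp add: V_def case_prod_unfold prod.distrib)
  \<comment> \<open>\<open>V n\<close> alone can be irrational, being a square root of a
    discriminant; expanding the fraction by \<open>V 1\<close> makes numerator and denominator
    rational.\<close>
  then have "(V n * V 1) / (V 1 * V 1) \<in> \<rat>" for n
    by (intro Rats_divide)
  moreover have "diff_quotient_power d \<alpha> n = (V n * V 1) / (V 1 * V 1)" for n
    by (simp add: quotient_eq)
  ultimately have quotient_Rats: "diff_quotient_power d \<alpha> n \<in> \<rat>" for n
    by metis
  show "\<exists>R. rat_rational_function R \<and> R has_fps_expansion g_series d \<alpha> \<and>
      (\<forall>w. \<not> R analytic_on {w} \<longrightarrow>
         simple_pole R w \<and> w \<in> inverse_monomial_values d \<alpha> (vandermonde_mpoly d))"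
  proof (rule mpoly_at_powers_rational_function[where K = "inverse (V 1)"])
    show "fps_nth (g_series d \<alpha>) n \<in> \<rat>" for n
      by (simp add: g_series_def quotient_Rats)
    show "fps_nth (g_series d \<alpha>) n =
        inverse (V 1) * linear_ext (monomial_value d (\<lambda>j. \<alpha> j ^ n)) (vandermonde_mpoly d)"
      if "n > 0" for n
      using that by (simp add: g_series_def linear_ext_vandermonde_mpoly quotient_eq V_def divide_inverse)
  qed (simp add: g_series_def)
qed

end
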